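(* Let $N\ge 2$ be an integer. Assume $u_0\in H^1(\mathbb T^2)$ is real-valued and has mean zero, let $u^0=\Pi_Nu_0$, and assume $\|u^0\|_{L^\infty(\mathbb T^2)}\le 1.25$. Put $E_0=\mathcal E(u^0)$, $$B_1=\frac{3.1}{99.8}\big(\sqrt{2E_0}+0.19676\,E_0\big)^4,\qquad B_2=\big(0.8988\sqrt{2E_0}+0.18692\,E_0\big)^4,$$ $$\tau_{\max}=\min\Big\{\frac12,\ \frac{1}{B_1(\ln B_1)^2},\ \frac89\,\frac1{B_2}\Big\},$$ where $\frac{1}{B_1(\ln B_1)^2}$ is read as $+\infty$ if $B_1=1$. Then for any $0<\tau\le\tau_{\max}$, the solution of the scheme $$\frac{u^{n+1}-u^n}{\tau}=-\Delta^2u^{n+1}+\Delta\Pi_N(f(u^n)),\quad n\ge 0,$$ satisfies $\mathcal E(u^{n+1})\le\mathcal E(u^n)$ for all $n\ge 0$.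
   Context: $\mathbb T^2=\mathbb R^2/\mathbb Z^2=[-\frac12,\frac12)^2$ is the $1$-periodic torus. $f(u)=u^3-u$. The energy (with $\nu=1$) is $$\mathcal E(u)=\int_{\mathbb T^2}\Big(\tfrac12|\nabla u|^2+\tfrac14(u^2-1)^2\Big)dx .$$ $\Pi_N$ is the $L^2$-projection onto $X_N=\operatorname{Span}\{\cos(2\pi k\cdot x),\sin(2\pi k\cdot x):k\in\mathbb Z^2,\ |k|_\infty\le N\}$, where $|k|_\infty=\max_j|k_j|$; i.e. $\Pi_N$ truncates to Fourier modes ($e^{2\pi i k\cdot x}$) with $|k|_\infty\le N$. Each $u^{n+1}\in X_N$ is uniquely determined by $u^n$ through the scheme. *)

theory Defs
  imports "HOL-Analysis.Analysis" "HOL-Probability.Essential_Supremum"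
begin

text \<open>
  Functions on the torus are represented by 1-periodic functions on the plane
  \<^typ>\<open>real \<times> real\<close>; integrals and norms are taken over the fundamental cell.
\<close>

definition cell :: "(real \<times> real) set" where
  "cell = {-1/2..<1/2} \<times> {-1/2..<1/2}"

abbreviation torus :: "(real \<times> real) measure" where
  "torus \<equiv> lebesgue_on cell"

definition periodic :: "(real \<times> real \<Rightarrow> real) \<Rightarrow> bool" where
  "periodic u \<longleftrightarrow> (\<forall>x y. u (x + 1, y) = u (x, y) \<and> u (x, y + 1) = u (x, y))"

definition mean_zero :: "(real \<times> real \<Rightarrow> real) \<Rightarrow> bool" where
  "mean_zero u \<longleftrightarrow> (\<integral>x. u x \<partial>torus) = 0"

definition Linfty_norm :: "(real \<times> real \<Rightarrow> real) \<Rightarrow> ereal" where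
  "Linfty_norm u = esssup torus (\<lambda>x. ereal \<bar>u x\<bar>)"

definition phase :: "int \<times> int \<Rightarrow> real \<times> real \<Rightarrow> real" where
  "phase k x = 2 * pi * (of_int (fst k) * fst x + of_int (snd k) * snd x)"

definition fourier_coeff :: "(real \<times> real \<Rightarrow> real) \<Rightarrow> int \<times> int \<Rightarrow> complex" where
  "fourier_coeff u k = (\<integral>x. complex_of_real (u x) * cis (- phase k x) \<partial>torus)"

definition H1 :: "(real \<times> real \<Rightarrow> real) \<Rightarrow> bool" where
  "H1 u \<longleftrightarrow> periodic u \<and> u \<in> borel_measurable torus \<and> integrable torus (\<lambda>x. (u x)\<^sup>2) \<and>
     (\<lambda>k. (1 + (of_int (fst k))\<^sup>2 + (of_int (snd k))\<^sup>2) * (cmod (fourier_coeff u k))\<^sup>2)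
       summable_on UNIV"

definition modes :: "nat \<Rightarrow> (int \<times> int) set" where
  "modes N = {k. max \<bar>fst k\<bar> \<bar>snd k\<bar> \<le> int N}"

text \<open>
  \<open>XN N\<close> is the real span of the finitely many functions \<open>cos (phase k)\<close> and \<open>sin (phase k)\<close>,
  written out because functions are not an instance of \<^class>\<open>real_vector\<close>.
\<close>

definition XN :: "nat \<Rightarrow> (real \<times> real \<Rightarrow> real) set" where
  "XN N = {u. \<exists>a b. u = (\<lambda>x. \<Sum>k\<in>modes N. a k * cos (phase k x) + b k * sin (phase k x))}"

definition fourier_trunc :: "nat \<Rightarrow> (real \<times> real \<Rightarrow> real) \<Rightarrow> real \<times> real \<Rightarrow> complex" where
  "fourier_trunc N u x = (\<Sum>k\<in>modes N. fourier_coeff u k * cis (phase k x))"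

text \<open>
  The truncated Fourier series of a real function is real (lemma \<open>fourier_trunc_real\<close> below), so
  \<^const>\<open>Re\<close> only changes the type.
\<close>

definition Proj :: "nat \<Rightarrow> (real \<times> real \<Rightarrow> real) \<Rightarrow> real \<times> real \<Rightarrow> real" where
  "Proj N u x = Re (fourier_trunc N u x)"

lemma fourier_coeff_uminus: "fourier_coeff u (- k) = cnj (fourier_coeff u k)"
proof -
  have "phase (- k) x = - phase k x" for x
    by (simp add: phase_def algebra_simps)
  then show ?thesis
    unfolding fourier_coeff_def by (simp add: cis_cnj flip: Bochner_Integration.integral_cnj)
qed

lemma fourier_trunc_real: "complex_of_real (Proj N u x) = fourier_trunc N u x"
proof -
  have ph: "phase (- k) x = - phase k x" for k
    by (simp add: phase_def algebra_simps)
  have "cnj (fourier_trunc N u x) = (\<Sum>k\<in>modes N. fourier_coeff u (- k) * cis (phase (- k) x))"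
    by (simp add: fourier_trunc_def fourier_coeff_uminus ph cis_cnj)
  also have "\<dots> = fourier_trunc N u x"
    unfolding fourier_trunc_def
    by (rule sum.reindex_bij_witness[of _ uminus uminus]) (auto simp: modes_def)
  finally show ?thesis
    unfolding Proj_def by (simp add: complex_eq_iff)
qed

lemma Proj_in_XN: "Proj N u \<in> XN N"
proof -
  have "Proj N u = (\<lambda>x. \<Sum>k\<in>modes N. Re (fourier_coeff u k) * cos (phase k x)
                       + (- Im (fourier_coeff u k)) * sin (phase k x))"
    by (rule ext) (simp add: Proj_def fourier_trunc_def)
  then show ?thesis
    unfolding XN_def mem_Collect_eq
    by (intro exI[of _ "\<lambda>k. Re (fourier_coeff u k)"] exI[of _ "\<lambda>k. - Im (fourier_coeff u k)"])
qed

text \<open>Derivatives are classical; they are only applied to trigonometric polynomials.\<close>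

definition dx :: "(real \<times> real \<Rightarrow> real) \<Rightarrow> real \<times> real \<Rightarrow> real" where
  "dx u p = deriv (\<lambda>s. u (s, snd p)) (fst p)"

definition dy :: "(real \<times> real \<Rightarrow> real) \<Rightarrow> real \<times> real \<Rightarrow> real" where
  "dy u p = deriv (\<lambda>s. u (fst p, s)) (snd p)"

definition laplacian :: "(real \<times> real \<Rightarrow> real) \<Rightarrow> real \<times> real \<Rightarrow> real" where
  "laplacian u p = dx (dx u) p + dy (dy u) p"

definition energy :: "(real \<times> real \<Rightarrow> real) \<Rightarrow> real" where
  "energy u = (\<integral>x. (1/2) * ((dx u x)\<^sup>2 + (dy u x)\<^sup>2) + (1/4) * ((u x)\<^sup>2 - 1)\<^sup>2 \<partial>torus)"

definition f_cubic :: "real \<Rightarrow> real" where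
  "f_cubic u = u ^ 3 - u"

definition scheme_solution ::
    "nat \<Rightarrow> real \<Rightarrow> (real \<times> real \<Rightarrow> real) \<Rightarrow> (nat \<Rightarrow> real \<times> real \<Rightarrow> real) \<Rightarrow> bool" where
  "scheme_solution N \<tau> u0 u \<longleftrightarrow>
     u 0 = Proj N u0 \<and>
     (\<forall>n. u (Suc n) \<in> XN N \<and>
       (\<forall>x. (u (Suc n) x - u n x) / \<tau>
            = - laplacian (laplacian (u (Suc n))) x + laplacian (Proj N (\<lambda>y. f_cubic (u n y))) x))"

definition B1 :: "real \<Rightarrow> real" where
  "B1 E = 3.1 / 99.8 * (sqrt (2 * E) + 0.19676 * E) ^ 4"

definition B2 :: "real \<Rightarrow> real" where
  "B2 E = (0.8988 * sqrt (2 * E) + 0.18692 * E) ^ 4"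

definition tau_max :: "real \<Rightarrow> ereal" where
  "tau_max E = Min {ereal (1/2),
                    (if B1 E = 1 then \<infinity> else ereal (1 / (B1 E * (ln (B1 E))\<^sup>2))),
                    ereal (8/9 * (1 / B2 E))}"

end

theory Submission
  imports Defs
begin

text \<open>
  Write \<open>\<lambda>\<^sub>k\<close> for the eigenvalue of \<open>-\<Delta>\<close> on the mode \<open>k\<close>, \<open>t = \<tau>\<^bsup>1/4\<^esup>\<close>, and let \<open>A\<close> be
  the sup norm at which \<open>(3 A\<^sup>2 - 1) / 2 = sqrt (2 / \<tau>)\<close>, that is
  \<open>A\<^sup>2 = 1/3 + 2 sqrt 2 / (3 t\<^sup>2)\<close>.  Up to the sup norm \<open>A\<close> the dissipation of one step
  outweighs the error of treating the nonlinearity explicitly; the iterates never exceed \<open>A\<close>.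
  
  Energy.  Let \<open>\<delta> = u\<^bsup>n+1\<^esup> - u\<^bsup>n\<^esup>\<close>.  Testing the scheme with \<open>(-\<Delta>)\<^bsup>-1\<^esup> \<delta>\<close> shows that a
  step dissipates \<open>(1 / (\<tau> \<lambda>\<^sub>k) + \<lambda>\<^sub>k / 2) |\<delta>\<^sub>k|\<^sup>2\<close> in every mode, which by the inequality of
  arithmetic and geometric means is at least \<open>sqrt (2 / \<tau>) |\<delta>\<^sub>k|\<^sup>2\<close>.  The explicit treatment of the
  cubic term costs at most \<open>(3 A\<^sup>2 - 1) / 2\<close> times \<open>\<integral> \<delta>\<^sup>2\<close> when both iterates are bounded by \<open>A\<close>,
  so the energy does not grow (\<open>energy_step_le\<close>).
  
  Sup norm.  In Fourier space a step reads
  \<open>(1 + \<tau> \<lambda>\<^sub>k\<^sup>2) V\<^sub>k = U\<^sub>k - \<tau> \<lambda>\<^sub>k F\<^sub>k\<close> with \<open>F\<close> the coefficients of \<open>f(u)\<close>.  The sequence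
  \<open>\<lambda>\<^sub>k |U\<^sub>k|\<^sup>2 / 2\<close> sums to the gradient part of the energy, and since \<open>|f(u)| \<le> A |u\<^sup>2 - 1|\<close> the
  sequence \<open>|F\<^sub>k|\<^sup>2 / (4 A\<^sup>2)\<close> sums to at most the potential part.  The Cauchy-Schwarz inequality
  therefore bounds \<open>(\<Sum> |V\<^sub>k|)\<^sup>2\<close> by the energy times a sum of squared multipliers
  (\<open>sup_step_le\<close>).  Both kinds of multipliers are dominated by multiples of
  \<open>\<lambda>\<^sub>k\<^bsup>-3/2\<^esup>\<close>, with factors \<open>1 / (2 t)\<close> and \<open>t / 2\<close> (\<open>multiplier_bounds\<close>), and \<open>\<Sum> \<lambda>\<^sub>k\<^bsup>-3/2\<^esup>\<close> is at most
  \<open>5 / 81\<close> for every truncation (\<open>sum_inverse_eigenvalue\<close>).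
  
  The restriction \<open>\<tau> \<le> 8 / (9 B\<^sub>2)\<close> makes the energy at most of order \<open>1 / t\<close>, so that the bound
  on \<open>|u\<^bsup>n+1\<^esup>|\<^sup>2\<close> is of the same order \<open>1 / t\<^sup>2\<close> as \<open>A\<^sup>2\<close>, and the constants leave it below
  \<open>A\<^sup>2\<close> (\<open>sup_bound_closes\<close>).  The restriction \<open>\<tau> \<le> 1/2\<close> puts the initial bound \<open>1.25\<close> below
  \<open>A\<close>, which starts the induction.
\<close>

section \<open>Integration over the torus\<close>

lemma cell_borel [measurable]: "cell \<in> sets borel"
proof -
  have "cell \<in> sets (borel \<Otimes>\<^sub>M borel)"
    unfolding cell_def by (intro pair_measureI) auto
  then show ?thesis unfolding borel_prod .
qed

lemma integral_torus_eq_lborel: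
  fixes g :: "real \<times> real \<Rightarrow> 'a::{banach,second_countable_topology}"
  assumes "g \<in> borel_measurable borel"
  shows "(\<integral>x. g x \<partial>torus) = (\<integral>x. indicator cell x *\<^sub>R g x \<partial>lborel)"
proof -
  have "(\<integral>x. g x \<partial>torus) = (\<integral>x. indicator cell x *\<^sub>R g x \<partial>lebesgue)"
    by (rule integral_restrict_space) auto
  also have "\<dots> = (\<integral>x. indicator cell x *\<^sub>R g x \<partial>lborel)"
    by (rule integral_completion) (use assms in measurable)
  finally show ?thesis .
qed

lemma integrable_torus_if_continuous:
  fixes g :: "real \<times> real \<Rightarrow> 'a::euclidean_space"
  assumes "continuous_on UNIV g"
  shows "integrable torus g"
proof -
  let ?K = "{-1/2..1/2} \<times> {-1/2..1/2} :: (real \<times> real) set"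
  have "compact ?K"
    by (intro compact_Times) auto
  then have "integrable lborel (\<lambda>x. indicator ?K x *\<^sub>R g x)"
    using assms continuous_on_subset by (intro borel_integrable_compact) auto
  then have "integrable lborel (\<lambda>x. indicator cell x *\<^sub>R (indicator ?K x *\<^sub>R g x))"
    by (rule integrable_mult_indicator[rotated]) simp
  moreover have "indicator cell x *\<^sub>R (indicator ?K x *\<^sub>R g x) = indicator cell x *\<^sub>R g x" for x
    by (auto simp: cell_def indicator_def)
  ultimately have "integrable lborel (\<lambda>x. indicator cell x *\<^sub>R g x)"
    by (simp only:)
  then have "integrable lebesgue (\<lambda>x. indicator cell x *\<^sub>R g x)"
    by (simp add: integrable_completion)
  then show ?thesis
    by (subst integrable_restrict_space) auto
qed

lemma integral_cis_unit_interval: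
  "(\<integral>x. indicator {-1/2..<1/2::real} x *\<^sub>R cis (2 * pi * (of_int j * x)) \<partial>lborel)
     = (if j = 0 then 1 else 0)"
proof -
  let ?I = "\<lambda>x. indicator {-1/2..1/2::real} x *\<^sub>R cis (2 * pi * (of_int j * x))"
  have "(\<integral>x. indicator {-1/2..<1/2::real} x *\<^sub>R cis (2 * pi * (of_int j * x)) \<partial>lborel)
      = (\<integral>x. ?I x \<partial>lborel)"
  proof (rule integral_cong_AE)
    have "AE x in lborel. x \<noteq> (1/2::real)"
      by (rule AE_lborel_singleton)
    then show "AE x in lborel. indicator {-1/2..<1/2::real} x *\<^sub>R cis (2 * pi * (of_int j * x)) = ?I x"
      by eventually_elim (auto simp: indicator_def)
  qed (intro borel_measurable_scaleR borel_measurable_indicator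
        borel_measurable_continuous_onI continuous_intros; simp)+
  also have "\<dots> = (if j = 0 then 1 else 0)"
  proof (cases "j = 0")
    case True
    then show ?thesis by (simp add: integral_scaleR_left)
  next
    case False
    define F where "F x = cis (2 * pi * (of_int j * x)) / (2 * pi * of_int j * \<i>)" for x
    have "(\<integral>x. ?I x \<partial>lborel) = F (1/2) - F (-1/2)"
    proof (rule integral_FTC_atLeastAtMost)
      show "(F has_vector_derivative cis (2 * pi * (of_int j * x))) (at x within {-1/2..1/2})" for x
        unfolding F_def has_vector_derivative_def
        by (rule derivative_eq_intros refl | use False in \<open>force simp: field_simps scaleR_conv_of_real\<close>)+
    qed (auto intro!: continuous_intros)
    also have "cis (2 * pi * (of_int j * (1/2))) = cis (2 * pi * (of_int j * (-1/2)))"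
    proof -
      have "2 * pi * (of_int j * (1/2)) = 2 * pi * (of_int j * (-1/2)) + 2 * pi * of_int j" by simp
      then show ?thesis by (metis cis_mult cis_multiple_2pi Ints_of_int mult.right_neutral)
    qed
    then have "F (1/2) - F (-1/2) = 0"
      unfolding F_def by simp
    finally show ?thesis using False by simp
  qed
  finally show ?thesis .
qed

lemma continuous_cis_phase [continuous_intros]: "continuous_on S (\<lambda>x. cis (phase k x))"
  unfolding phase_def by (intro continuous_intros)

lemma integral_cis_phase: "(\<integral>x. cis (phase k x) \<partial>torus) = (if k = 0 then 1 else 0)"
proof -
  let ?h = "\<lambda>j x. indicator {-1/2..<1/2::real} x *\<^sub>R cis (2 * pi * (of_int j * x))"
  let ?g = "\<lambda>x. indicator cell x *\<^sub>R cis (phase k x)"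
  have split: "?g (x, y) = ?h (fst k) x * ?h (snd k) y" for x y
    by (auto simp: phase_def cell_def indicator_def cis_mult algebra_simps)
  have meas: "(\<lambda>x. cis (phase k x)) \<in> borel_measurable borel"
    by (intro borel_measurable_continuous_onI continuous_intros)
  have "integrable torus (\<lambda>x. cis (phase k x))"
    by (intro integrable_torus_if_continuous continuous_intros)
  then have "integrable lebesgue ?g"
    by (subst (asm) integrable_restrict_space) auto
  moreover have "?g \<in> borel_measurable lborel"
    using meas by measurable
  ultimately have "integrable lborel ?g"
    by (simp add: integrable_completion)
  then have int: "integrable (lborel \<Otimes>\<^sub>M lborel) ?g"
    by (simp add: lborel_prod)
  have "(\<integral>x. cis (phase k x) \<partial>torus) = (\<integral>x. ?g x \<partial>(lborel \<Otimes>\<^sub>M lborel))"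
    using integral_torus_eq_lborel[OF meas] by (simp add: lborel_prod)
  also have "\<dots> = (\<integral>x. \<integral>y. ?g (x, y) \<partial>lborel \<partial>lborel)"
    by (rule lborel_pair.integral_fst'[OF int, symmetric])
  also have "\<dots> = (\<integral>x. ?h (fst k) x \<partial>lborel) * (\<integral>y. ?h (snd k) y \<partial>lborel)"
    unfolding split integral_mult_right_zero integral_mult_left_zero ..
  also have "\<dots> = (if k = 0 then 1 else 0)"
    unfolding integral_cis_unit_interval by (auto simp: prod_eq_iff)
  finally show ?thesis .
qed

section \<open>Fourier analysis of real trigonometric polynomials\<close>

definition hermitian :: "(int \<times> int \<Rightarrow> complex) \<Rightarrow> bool" where
  "hermitian c \<longleftrightarrow> (\<forall>k. c (- k) = cnj (c k))"

text \<open>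
  Real parts are taken termwise, so that \<open>trig_poly N c\<close> is real for any family \<open>c\<close>; it is the
  Fourier sum with coefficients \<open>c\<close> when \<open>c\<close> is Hermitian (\<open>trig_poly_complex\<close> below).
\<close>

definition trig_poly :: "nat \<Rightarrow> (int \<times> int \<Rightarrow> complex) \<Rightarrow> real \<times> real \<Rightarrow> real" where
  "trig_poly N c x = (\<Sum>k\<in>modes N. Re (c k * cis (phase k x)))"

lemma modes_eq: "modes N = {- int N..int N} \<times> {- int N..int N}"
  by (auto simp: modes_def)

lemma finite_modes [simp]: "finite (modes N)"
  by (simp add: modes_eq)

lemma uminus_modes [simp]: "- k \<in> modes N \<longleftrightarrow> k \<in> modes N"
  by (auto simp: modes_def)

lemma phase_uminus: "phase (- k) x = - phase k x"
  by (simp add: phase_def algebra_simps)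

lemma phase_diff: "phase (k - l) x = phase k x - phase l x"
  by (simp add: phase_def algebra_simps)

lemma sum_modes_uminus: "(\<Sum>k\<in>modes N. g (- k)) = (\<Sum>k\<in>modes N. g k)"
  by (rule sum.reindex_bij_witness[of _ uminus uminus]) auto

lemma hermitian_fourier_coeff [simp]: "hermitian (fourier_coeff u)"
  by (simp add: hermitian_def fourier_coeff_uminus)

lemma hermitian_diff: "hermitian c \<Longrightarrow> hermitian d \<Longrightarrow> hermitian (\<lambda>k. c k - d k)"
  by (simp add: hermitian_def)

lemma hermitian_mult_even:
  assumes "hermitian c" "\<And>k. g (- k) = (g k :: real)"
  shows "hermitian (\<lambda>k. of_real (g k) * c k)"
  using assms by (simp add: hermitian_def)

lemma hermitian_mult_odd:
  assumes "hermitian c" "\<And>k. g (- k) = - (g k :: real)"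
  shows "hermitian (\<lambda>k. \<i> * of_real (g k) * c k)"
  using assms by (simp add: hermitian_def)

lemma trig_poly_complex:
  assumes "hermitian c"
  shows "complex_of_real (trig_poly N c x) = (\<Sum>k\<in>modes N. c k * cis (phase k x))"
proof -
  let ?S = "\<Sum>k\<in>modes N. c k * cis (phase k x)"
  have "cnj ?S = (\<Sum>k\<in>modes N. c (- k) * cis (phase (- k) x))"
    using assms by (simp add: hermitian_def phase_uminus cis_cnj del: split_paired_All)
  also have "\<dots> = ?S"
    by (rule sum_modes_uminus)
  finally have "Im ?S = 0"
    by (simp only: flip: Reals_cnj_iff complex_is_Real_iff)
  moreover have "Re ?S = trig_poly N c x"
    by (simp add: trig_poly_def)
  ultimately show ?thesis
    by (simp only: complex_eq_iff Re_complex_of_real Im_complex_of_real)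
qed

lemma continuous_trig_poly [continuous_intros]: "continuous_on S (trig_poly N c)"
  unfolding trig_poly_def by (intro continuous_intros)

lemma trig_poly_diff: "trig_poly N c x - trig_poly N d x = trig_poly N (\<lambda>k. c k - d k) x"
  by (simp add: trig_poly_def left_diff_distrib flip: sum_subtractf)

lemma trig_poly_add: "trig_poly N c x + trig_poly N d x = trig_poly N (\<lambda>k. c k + d k) x"
  by (simp add: trig_poly_def distrib_right flip: sum.distrib)

lemma trig_poly_scale: "a * trig_poly N c x = trig_poly N (\<lambda>k. of_real a * c k) x"
  by (simp add: trig_poly_def sum_distrib_left algebra_simps)

lemma abs_trig_poly_le: "\<bar>trig_poly N c x\<bar> \<le> (\<Sum>k\<in>modes N. cmod (c k))"
proof -
  have "\<bar>trig_poly N c x\<bar> \<le> (\<Sum>k\<in>modes N. \<bar>Re (c k * cis (phase k x))\<bar>)"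
    unfolding trig_poly_def by (rule sum_abs)
  also have "\<dots> \<le> (\<Sum>k\<in>modes N. cmod (c k))"
    by (intro sum_mono order_trans[OF abs_Re_le_cmod]) (simp add: norm_mult)
  finally show ?thesis .
qed

lemma fourier_coeff_trig_poly:
  assumes "hermitian c" "k \<in> modes N"
  shows "fourier_coeff (trig_poly N c) k = c k"
proof -
  have "fourier_coeff (trig_poly N c) k = (\<integral>x. (\<Sum>l\<in>modes N. c l * cis (phase (l - k) x)) \<partial>torus)"
  proof -
    have "complex_of_real (trig_poly N c x) * cis (- phase k x)
        = (\<Sum>l\<in>modes N. c l * cis (phase (l - k) x))" for x
      unfolding trig_poly_complex[OF assms(1)] sum_distrib_right
      by (intro sum.cong) (simp_all add: phase_diff cis_mult mult.assoc)
    then show ?thesis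
      by (simp add: fourier_coeff_def)
  qed
  also have "\<dots> = (\<Sum>l\<in>modes N. c l * (\<integral>x. cis (phase (l - k) x) \<partial>torus))"
    by (subst Bochner_Integration.integral_sum)
       (auto intro!: integrable_torus_if_continuous continuous_intros)
  also have "\<dots> = (\<Sum>l\<in>modes N. if l = k then c l else 0)"
    by (intro sum.cong) (auto simp: integral_cis_phase)
  also have "\<dots> = c k"
    using assms(2) by simp
  finally show ?thesis .
qed

lemma Proj_eq_trig_poly: "Proj N u = trig_poly N (fourier_coeff u)"
  by (rule ext) (simp add: Proj_def fourier_trunc_def trig_poly_def)

text \<open>
  The coefficients in the definition of \<^const>\<open>XN\<close> are not unique, since \<open>k\<close> and \<open>- k\<close> give
  proportional functions.  Averaging them over \<open>k\<close> and \<open>- k\<close> makes them Hermitian without changing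
  the function, and Hermitian coefficients are the Fourier coefficients.
\<close>

lemma XN_eq_trig_poly:
  assumes "v \<in> XN N"
  shows "v = trig_poly N (fourier_coeff v)"
proof -
  obtain a b where v: "v = (\<lambda>x. \<Sum>k\<in>modes N. a k * cos (phase k x) + b k * sin (phase k x))"
    using assms unfolding XN_def by auto
  define d where "d k = Complex (a k) (- b k)" for k
  define c where "c k = (d k + cnj (d (- k))) / 2" for k
  have herm: "hermitian c"
    by (simp add: hermitian_def c_def add.commute)
  have vd: "v x = (\<Sum>k\<in>modes N. Re (d k * cis (phase k x)))" for x
    by (simp add: v d_def)
  have "v x = trig_poly N c x" for x
  proof -
    have "(\<Sum>k\<in>modes N. Re (cnj (d (- k)) * cis (phase k x)))
        = (\<Sum>k\<in>modes N. Re (cnj (d (- (- k))) * cis (phase (- k) x)))"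
      by (rule sum_modes_uminus[symmetric])
    also have "\<dots> = v x"
      by (simp add: vd phase_uminus)
    finally have refl: "(\<Sum>k\<in>modes N. Re (cnj (d (- k)) * cis (phase k x))) = v x" .
    have "trig_poly N c x = ((\<Sum>k\<in>modes N. Re (d k * cis (phase k x)))
        + (\<Sum>k\<in>modes N. Re (cnj (d (- k)) * cis (phase k x)))) / 2"
      unfolding trig_poly_def c_def
      by (simp add: algebra_simps add_divide_distrib sum.distrib flip: sum_divide_distrib)
    also have "\<dots> = v x"
      unfolding refl vd[symmetric] by simp
    finally show ?thesis ..
  qed
  then have vc: "v = trig_poly N c" by auto
  have "trig_poly N (fourier_coeff v) = trig_poly N c"
    unfolding trig_poly_def by (intro ext sum.cong) (auto simp: vc fourier_coeff_trig_poly[OF herm])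
  with vc show ?thesis by simp
qed

lemma integral_mult_trig_poly:
  assumes "hermitian c" "continuous_on UNIV h"
  shows "(\<integral>x. h x * trig_poly N c x \<partial>torus) = (\<Sum>k\<in>modes N. Re (fourier_coeff h k * cnj (c k)))"
proof -
  have int: "(\<integral>x. complex_of_real (h x) * cis (phase k x) \<partial>torus) = cnj (fourier_coeff h k)" for k
    using fourier_coeff_uminus[of h k] by (simp add: fourier_coeff_def phase_uminus)
  have "complex_of_real (\<integral>x. h x * trig_poly N c x \<partial>torus)
      = (\<integral>x. complex_of_real (h x) * (\<Sum>k\<in>modes N. c k * cis (phase k x)) \<partial>torus)"
    by (simp add: trig_poly_complex[OF assms(1), symmetric] flip: integral_complex_of_real)
  also have "\<dots> = (\<integral>x. (\<Sum>k\<in>modes N. c k * (complex_of_real (h x) * cis (phase k x))) \<partial>torus)"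
    by (simp add: sum_distrib_left mult_ac)
  also have "\<dots> = (\<Sum>k\<in>modes N. c k * cnj (fourier_coeff h k))"
    by (subst Bochner_Integration.integral_sum)
       (auto simp: int intro!: integrable_torus_if_continuous continuous_intros assms(2))
  finally have "(\<integral>x. h x * trig_poly N c x \<partial>torus) = Re (\<Sum>k\<in>modes N. c k * cnj (fourier_coeff h k))"
    by (metis Re_complex_of_real)
  then show ?thesis
    by (simp add: algebra_simps)
qed

lemma parseval_trig_poly:
  assumes "hermitian c"
  shows "(\<integral>x. (trig_poly N c x)\<^sup>2 \<partial>torus) = (\<Sum>k\<in>modes N. (cmod (c k))\<^sup>2)"
proof -
  have "(\<integral>x. (trig_poly N c x)\<^sup>2 \<partial>torus)
      = (\<Sum>k\<in>modes N. Re (fourier_coeff (trig_poly N c) k * cnj (c k)))"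
    unfolding power2_eq_square
    by (rule integral_mult_trig_poly[OF assms]) (intro continuous_intros)
  also have "\<dots> = (\<Sum>k\<in>modes N. (cmod (c k))\<^sup>2)"
    by (intro sum.cong) (auto simp: fourier_coeff_trig_poly[OF assms] complex_mult_cnj cmod_power2)
  finally show ?thesis .
qed

text \<open>
  The square of the distance from \<open>h\<close> to its truncated Fourier series is nonnegative.
\<close>

lemma bessel_inequality:
  assumes "continuous_on UNIV h"
  shows "(\<Sum>k\<in>modes N. (cmod (fourier_coeff h k))\<^sup>2) \<le> (\<integral>x. (h x)\<^sup>2 \<partial>torus)"
proof -
  let ?p = "trig_poly N (fourier_coeff h)" and ?S = "\<Sum>k\<in>modes N. (cmod (fourier_coeff h k))\<^sup>2"
  have "0 \<le> (\<integral>x. (h x - ?p x)\<^sup>2 \<partial>torus)"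
    by simp
  also have "\<dots> = (\<integral>x. (h x)\<^sup>2 - 2 * (h x * ?p x) + (?p x)\<^sup>2 \<partial>torus)"
    by (simp add: power2_eq_square algebra_simps)
  also have "\<dots> = (\<integral>x. (h x)\<^sup>2 \<partial>torus) - 2 * (\<integral>x. h x * ?p x \<partial>torus) + (\<integral>x. (?p x)\<^sup>2 \<partial>torus)"
    by (subst Bochner_Integration.integral_add Bochner_Integration.integral_diff;
        (intro Bochner_Integration.integrable_diff integrable_torus_if_continuous continuous_intros assms)?)+
       simp
  also have "(\<integral>x. h x * ?p x \<partial>torus) = ?S"
    unfolding integral_mult_trig_poly[OF hermitian_fourier_coeff assms]
    by (intro sum.cong) (auto simp: complex_mult_cnj cmod_power2)
  also have "(\<integral>x. (?p x)\<^sup>2 \<partial>torus) = ?S"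
    by (rule parseval_trig_poly) simp
  finally show ?thesis by simp
qed

lemma trig_poly_eqD:
  assumes "hermitian c" "hermitian d" "\<And>x. trig_poly N c x = trig_poly N d x" "k \<in> modes N"
  shows "c k = d k"
proof -
  have "trig_poly N c = trig_poly N d" using assms(3) by auto
  then show ?thesis
    using assms fourier_coeff_trig_poly by metis
qed

lemma dx_trig_poly: "dx (trig_poly N c) = trig_poly N (\<lambda>k. \<i> * of_real (2 * pi * of_int (fst k)) * c k)"
  unfolding dx_def trig_poly_def phase_def
  by (intro ext DERIV_imp_deriv, simp)
     (rule derivative_eq_intros refl sum.cong | simp add: algebra_simps sum_subtractf)+

lemma dy_trig_poly: "dy (trig_poly N c) = trig_poly N (\<lambda>k. \<i> * of_real (2 * pi * of_int (snd k)) * c k)"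
  unfolding dy_def trig_poly_def phase_def
  by (intro ext DERIV_imp_deriv, simp)
     (rule derivative_eq_intros refl sum.cong | simp add: algebra_simps sum_subtractf)+

section \<open>Laplacian and energy in Fourier space\<close>

text \<open>
  The eigenvalue of \<open>-\<Delta>\<close> on the mode \<open>k\<close>.
\<close>

definition eigenvalue :: "int \<times> int \<Rightarrow> real" where
  "eigenvalue k = (2 * pi)\<^sup>2 * ((of_int (fst k))\<^sup>2 + (of_int (snd k))\<^sup>2)"

lemma eigenvalue_uminus [simp]: "eigenvalue (- k) = eigenvalue k"
  by (simp add: eigenvalue_def)

lemma eigenvalue_0 [simp]: "eigenvalue 0 = 0"
  by (simp add: eigenvalue_def)

lemma eigenvalue_pos: "k \<noteq> 0 \<Longrightarrow> 0 < eigenvalue k"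
  by (auto simp: eigenvalue_def prod_eq_iff sum_power2_gt_zero_iff)

lemma eigenvalue_nonneg [simp]: "0 \<le> eigenvalue k"
  by (simp add: eigenvalue_def)

lemma laplacian_trig_poly: "laplacian (trig_poly N c) = trig_poly N (\<lambda>k. of_real (- eigenvalue k) * c k)"
proof
  fix x
  show "laplacian (trig_poly N c) x = trig_poly N (\<lambda>k. of_real (- eigenvalue k) * c k) x"
    unfolding laplacian_def dx_trig_poly dy_trig_poly trig_poly_add
    by (rule arg_cong[where f = "\<lambda>c. trig_poly N c x"])
       (simp add: fun_eq_iff eigenvalue_def power2_eq_square complex_eq_iff algebra_simps)
qed

lemma energy_trig_poly:
  assumes "hermitian c"
  shows "energy (trig_poly N c) = (\<Sum>k\<in>modes N. eigenvalue k * (cmod (c k))\<^sup>2) / 2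
           + (\<integral>x. ((trig_poly N c x)\<^sup>2 - 1)\<^sup>2 \<partial>torus) / 4"
proof -
  let ?v = "trig_poly N c"
  have gx: "(\<integral>x. (dx ?v x)\<^sup>2 \<partial>torus) = (\<Sum>k\<in>modes N. (2 * pi * of_int (fst k))\<^sup>2 * (cmod (c k))\<^sup>2)"
    unfolding dx_trig_poly
    by (subst parseval_trig_poly[OF hermitian_mult_odd[OF assms]])
       (simp_all add: norm_mult power_mult_distrib)
  have gy: "(\<integral>x. (dy ?v x)\<^sup>2 \<partial>torus) = (\<Sum>k\<in>modes N. (2 * pi * of_int (snd k))\<^sup>2 * (cmod (c k))\<^sup>2)"
    unfolding dy_trig_poly
    by (subst parseval_trig_poly[OF hermitian_mult_odd[OF assms]])
       (simp_all add: norm_mult power_mult_distrib)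
  have "energy ?v = (1/2) * ((\<integral>x. (dx ?v x)\<^sup>2 \<partial>torus) + (\<integral>x. (dy ?v x)\<^sup>2 \<partial>torus))
      + (1/4) * (\<integral>x. ((?v x)\<^sup>2 - 1)\<^sup>2 \<partial>torus)"
  proof -
    have "integrable torus (\<lambda>x. (dx ?v x)\<^sup>2)" "integrable torus (\<lambda>x. (dy ?v x)\<^sup>2)"
         "integrable torus (\<lambda>x. ((?v x)\<^sup>2 - 1)\<^sup>2)"
      unfolding dx_trig_poly dy_trig_poly
      by (intro integrable_torus_if_continuous continuous_intros)+
    then show ?thesis
      unfolding energy_def by simp
  qed
  also have "(\<integral>x. (dx ?v x)\<^sup>2 \<partial>torus) + (\<integral>x. (dy ?v x)\<^sup>2 \<partial>torus)
      = (\<Sum>k\<in>modes N. eigenvalue k * (cmod (c k))\<^sup>2)"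
    unfolding gx gy eigenvalue_def
    by (simp add: power_mult_distrib algebra_simps flip: sum.distrib)
  finally show ?thesis by simp
qed

lemma energy_nonneg: "0 \<le> energy v"
  unfolding energy_def by (intro integral_nonneg_AE) auto

section \<open>Lattice sums and multipliers\<close>

definition sup_norm_index :: "int \<times> int \<Rightarrow> int" where
  "sup_norm_index k = max \<bar>fst k\<bar> \<bar>snd k\<bar>"

lemma card_modes: "card (modes N) = (2 * N + 1)\<^sup>2"
proof -
  have "card (modes N) = nat (2 * int N + 1) * nat (2 * int N + 1)"
    by (simp add: modes_eq card_cartesian_product algebra_simps)
  also have "nat (2 * int N + 1) = 2 * N + 1" by simp
  finally show ?thesis by (simp add: power2_eq_square)
qed

text \<open>
  The frequencies with maximum norm \<open>m\<close> form a square shell of \<open>8 m\<close> points, so the sum is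
  \<open>8 \<Sum> 1 / m\<^sup>2\<close>.  The bound is exact for the first shell and telescopes from there by
  \<open>1 / m\<^sup>2 \<le> 1 / (m - 1/2) - 1 / (m + 1/2)\<close>.
\<close>

lemma sum_inverse_cube_shells:
  "(\<Sum>k\<in>modes (Suc n) - {0}. 1 / of_int (sup_norm_index k) ^ 3) \<le> (40/3 - 8 / (of_nat n + 3/2) :: real)"
proof -
  let ?g = "\<lambda>k. 1 / of_int (sup_norm_index k) ^ 3 :: real"
  have sub: "modes m \<subseteq> modes (Suc m)" for m
    by (auto simp: modes_def)
  have shell: "(\<Sum>k\<in>modes (Suc m) - modes m. ?g k) = 8 / (real m + 1)\<^sup>2" for m
  proof -
    have "(\<Sum>k\<in>modes (Suc m) - modes m. ?g k) = (\<Sum>k\<in>modes (Suc m) - modes m. 1 / (real m + 1) ^ 3)"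
    proof (intro sum.cong refl)
      fix k assume "k \<in> modes (Suc m) - modes m"
      then have "sup_norm_index k = int m + 1"
        by (auto simp: modes_def sup_norm_index_def)
      then show "?g k = 1 / (real m + 1) ^ 3" by simp
    qed
    also have "\<dots> = real (card (modes (Suc m) - modes m)) / (real m + 1) ^ 3"
      by simp
    also have "real (card (modes (Suc m) - modes m)) = 8 * (real m + 1)"
      using card_mono[OF finite_modes sub, of m]
      by (subst card_Diff_subset) (auto simp: sub card_modes of_nat_diff power2_eq_square algebra_simps)
    also have "8 * (real m + 1) / (real m + 1) ^ 3 = 8 / (real m + 1)\<^sup>2"
    proof -
      have cancel: "8 * c / c ^ 3 = 8 / c\<^sup>2" if "0 < c" for c :: real
        using that by (simp add: power2_eq_square power3_eq_cube)
      show ?thesis by (rule cancel) simp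
    qed
    finally show ?thesis .
  qed
  show ?thesis
  proof (induction n)
    case 0
    have "modes 0 = {0}" by (auto simp: modes_def prod_eq_iff)
    with shell[of 0] show ?case by simp
  next
    case (Suc n)
    have "modes (Suc (Suc n)) - {0} = (modes (Suc n) - {0}) \<union> (modes (Suc (Suc n)) - modes (Suc n))"
      using sub[of "Suc n"] by (auto simp: modes_def)
    then have "(\<Sum>k\<in>modes (Suc (Suc n)) - {0}. ?g k)
        = (\<Sum>k\<in>modes (Suc n) - {0}. ?g k) + (\<Sum>k\<in>modes (Suc (Suc n)) - modes (Suc n). ?g k)"
      by (simp only:) (rule sum.union_disjoint; auto)
    also have "\<dots> \<le> 40/3 - 8 / (of_nat n + 3/2) + 8 / (real (Suc n) + 1)\<^sup>2"
      using Suc shell[of "Suc n"] by simp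
    also have "8 / (real (Suc n) + 1)\<^sup>2 \<le> 8 / (of_nat n + 3/2) - 8 / (of_nat (Suc n) + 3/2)"
    proof -
      have "8 / (of_nat n + 3/2) - 8 / (of_nat (Suc n) + 3/2) = 8 / ((real n + 3/2) * (real n + 5/2))"
        by (simp add: divide_simps)
      moreover have "(real n + 3/2) * (real n + 5/2) \<le> (real (Suc n) + 1)\<^sup>2"
        by (simp add: power2_eq_square algebra_simps)
      ultimately show ?thesis
        by (simp only:) (intro divide_left_mono mult_pos_pos; simp)
    qed
    finally show ?case by simp
  qed
qed

text \<open>
  \<open>sqrt (eigenvalue k)\<close> is \<open>2 * pi\<close> times the Euclidean norm of \<open>k\<close>, hence at least \<open>6\<close> times its
  maximum norm, and \<open>(40/3) / 6\<^sup>3 = 5/81\<close>.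
\<close>

lemma sum_inverse_eigenvalue:
  "(\<Sum>k\<in>modes N - {0}. 1 / sqrt (eigenvalue k) ^ 3) \<le> 5 / 81"
proof -
  let ?g = "\<lambda>k. 1 / of_int (sup_norm_index k) ^ 3 :: real"
  have "(\<Sum>k\<in>modes N - {0}. 1 / sqrt (eigenvalue k) ^ 3) \<le> (\<Sum>k\<in>modes N - {0}. (1 / 216) * ?g k)"
  proof (intro sum_mono)
    fix k assume "k \<in> modes N - {0}"
    then have m: "0 < sup_norm_index k" and pos: "0 < eigenvalue k"
      by (auto simp: sup_norm_index_def prod_eq_iff intro!: eigenvalue_pos)
    have "(of_int (sup_norm_index k))\<^sup>2 \<le> (of_int (fst k))\<^sup>2 + (of_int (snd k) :: real)\<^sup>2"
      by (auto simp: sup_norm_index_def max_def)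
    moreover have "6\<^sup>2 \<le> (2 * pi)\<^sup>2"
      using pi_gt3 by (intro power_mono) auto
    ultimately have "6\<^sup>2 * (of_int (sup_norm_index k))\<^sup>2 \<le> eigenvalue k"
      unfolding eigenvalue_def by (intro mult_mono) auto
    then have "6 * of_int (sup_norm_index k) \<le> sqrt (eigenvalue k)"
      by (intro real_le_rsqrt) (simp add: power_mult_distrib)
    then have "(6 * of_int (sup_norm_index k)) ^ 3 \<le> sqrt (eigenvalue k) ^ 3"
      using m by (intro power_mono) auto
    then have "1 / sqrt (eigenvalue k) ^ 3 \<le> 1 / (6 * of_int (sup_norm_index k)) ^ 3"
      using m pos by (intro divide_left_mono mult_pos_pos zero_less_power) auto
    then show "1 / sqrt (eigenvalue k) ^ 3 \<le> (1 / 216) * ?g k"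
      by (simp add: power_mult_distrib)
  qed
  also have "\<dots> = (1 / 216) * (\<Sum>k\<in>modes N - {0}. ?g k)"
    by (simp only: sum_distrib_left)
  also have "(\<Sum>k\<in>modes N - {0}. ?g k) \<le> 40/3"
  proof (cases N)
    case 0
    then have "modes N - {0} = {}" by (auto simp: modes_def prod_eq_iff)
    then show ?thesis by (simp only:) simp
  next
    case (Suc n)
    have "0 \<le> 8 / (real n + 3/2)" by simp
    then show ?thesis
      using sum_inverse_cube_shells[of n] unfolding Suc by linarith
  qed
  finally show ?thesis by simp
qed

text \<open>
  With \<open>r\<^sup>2\<close> an eigenvalue and \<open>\<tau> = t\<^sup>4\<close>, these bound the squared multipliers of
  \<open>(-\<Delta>)\<^bsup>-1/2\<^esup> (1 + \<tau> \<Delta>\<^sup>2)\<^bsup>-1\<^esup>\<close>, which meets the gradient of the old iterate, and of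
  \<open>\<tau> \<Delta> (1 + \<tau> \<Delta>\<^sup>2)\<^bsup>-1\<^esup>\<close>, which meets the nonlinearity.  The exponent \<open>3\<close> of \<open>r\<close> is chosen because both then have the same summable
  majorant in two dimensions.
\<close>

lemma multiplier_bounds:
  fixes r t :: real
  assumes "0 < r" "0 < t"
  shows "1 / (r\<^sup>2 * (1 + (t * r) ^ 4)\<^sup>2) \<le> 1 / (2 * t * r ^ 3)"
    and "t ^ 8 * r ^ 4 / (1 + (t * r) ^ 4)\<^sup>2 \<le> t / (2 * r ^ 3)"
proof -
  \<comment> \<open>In terms of \<open>y = t * r\<close> the two bounds are a pair of polynomial inequalities exchanged by
    \<open>y \<mapsto> 1 / y\<close>; both are sums of squares.\<close>
  have poly: "2 * y \<le> (1 + y ^ 4)\<^sup>2" "2 * y ^ 7 \<le> (1 + y ^ 4)\<^sup>2" for y :: real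
  proof -
    have "(1 + y ^ 4)\<^sup>2 - 2 * y = y ^ 8 + 2 * (y\<^sup>2 - 1/2)\<^sup>2 + 2 * (y - 1/2)\<^sup>2"
      by (simp add: power2_diff power2_sum power_mult[symmetric] field_simps)
    also have "\<dots> \<ge> 0" by simp
    finally show "2 * y \<le> (1 + y ^ 4)\<^sup>2" by simp
    have "(1 + y ^ 4)\<^sup>2 - 2 * y ^ 7 = 1 + y ^ 4 * (y ^ 4 - 2 * y ^ 3 + 2)"
      by (simp add: power2_sum algebra_simps flip: power_mult power_add)
    also have "y ^ 4 - 2 * y ^ 3 + 2 = (y\<^sup>2 - y - 3/4)\<^sup>2 + (y - 3/2)\<^sup>2 / 2 + 5/16"
      by (simp add: power2_eq_square power3_eq_cube power4_eq_xxxx field_simps)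
    also have "1 + y ^ 4 * \<dots> \<ge> 0" by simp
    finally show "2 * y ^ 7 \<le> (1 + y ^ 4)\<^sup>2" by simp
  qed
  have "2 * t * r ^ 3 = r\<^sup>2 * (2 * (t * r))"
    by (simp add: power2_eq_square power3_eq_cube)
  also have "\<dots> \<le> r\<^sup>2 * (1 + (t * r) ^ 4)\<^sup>2"
    by (intro mult_left_mono poly) auto
  finally have "2 * t * r ^ 3 \<le> r\<^sup>2 * (1 + (t * r) ^ 4)\<^sup>2" .
  then show "1 / (r\<^sup>2 * (1 + (t * r) ^ 4)\<^sup>2) \<le> 1 / (2 * t * r ^ 3)"
    using assms by (intro divide_left_mono) (auto intro!: mult_pos_pos zero_less_power add_pos_pos)
  have pos: "0 < (1 + (t * r) ^ 4)\<^sup>2" "0 < 2 * r ^ 3"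
    using assms by (intro zero_less_power mult_pos_pos add_pos_nonneg; simp)+
  have "t ^ 8 * r ^ 4 * (2 * r ^ 3) = t * (2 * (t * r) ^ 7)"
    by (simp add: power_mult_distrib eval_nat_numeral)
  also have "\<dots> \<le> t * (1 + (t * r) ^ 4)\<^sup>2"
    using assms by (intro mult_left_mono poly) auto
  finally show "t ^ 8 * r ^ 4 / (1 + (t * r) ^ 4)\<^sup>2 \<le> t / (2 * r ^ 3)"
    using pos by (simp only: pos_divide_le_eq times_divide_eq_left pos_le_divide_eq)
qed

section \<open>One step of the scheme\<close>

text \<open>
  One step of the scheme in Fourier space, multiplied by \<open>\<tau>\<close>.
\<close>

definition scheme_coeffs ::
    "nat \<Rightarrow> real \<Rightarrow> (int \<times> int \<Rightarrow> complex) \<Rightarrow> (int \<times> int \<Rightarrow> complex) \<Rightarrow> bool" where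
  "scheme_coeffs N \<tau> U V \<longleftrightarrow> (\<forall>k\<in>modes N.
     V k - U k = - of_real (\<tau> * (eigenvalue k)\<^sup>2) * V k
       - of_real (\<tau> * eigenvalue k) * fourier_coeff (\<lambda>x. f_cubic (trig_poly N U x)) k)"

lemma scheme_coeffs_if_step:
  assumes "0 < \<tau>" "hermitian U" "hermitian V"
    and step: "\<And>x. (trig_poly N V x - trig_poly N U x) / \<tau>
      = - laplacian (laplacian (trig_poly N V)) x
        + laplacian (Proj N (\<lambda>y. f_cubic (trig_poly N U y))) x"
  shows "scheme_coeffs N \<tau> U V"
  unfolding scheme_coeffs_def
proof
  fix k assume k: "k \<in> modes N"
  let ?F = "fourier_coeff (\<lambda>y. f_cubic (trig_poly N U y))"
  let ?L = "\<lambda>k. complex_of_real (- eigenvalue k)"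
  have "trig_poly N (\<lambda>k. of_real (1 / \<tau>) * (V k - U k)) x
      = trig_poly N (\<lambda>k. ?L k * ?F k - ?L k * (?L k * V k)) x" for x
    using step[of x]
    by (simp only: Proj_eq_trig_poly laplacian_trig_poly trig_poly_diff flip: trig_poly_scale)
       (simp add: laplacian_trig_poly flip: trig_poly_diff)
  moreover have "hermitian (\<lambda>k. of_real (1 / \<tau>) * (V k - U k))"
    by (intro hermitian_mult_even hermitian_diff assms) auto
  moreover have "hermitian (\<lambda>k. ?L k * ?F k - ?L k * (?L k * V k))"
    by (intro hermitian_diff hermitian_mult_even assms hermitian_fourier_coeff) auto
  ultimately have "of_real (1 / \<tau>) * (V k - U k) = ?L k * ?F k - ?L k * (?L k * V k)"
    using k by (intro trig_poly_eqD[of "\<lambda>k. of_real (1 / \<tau>) * (V k - U k)"])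
  then have "of_real \<tau> * (of_real (1 / \<tau>) * (V k - U k)) = of_real \<tau> * (?L k * ?F k - ?L k * (?L k * V k))"
    by simp
  then show "V k - U k = - of_real (\<tau> * (eigenvalue k)\<^sup>2) * V k - of_real (\<tau> * eigenvalue k) * ?F k"
    using \<open>0 < \<tau>\<close> by (simp add: power2_eq_square algebra_simps)
qed

text \<open>
  The Taylor expansion of the double-well potential at \<open>u\<close> with an exact remainder, whose second
  factor is at most \<open>(3 A\<^sup>2 - 1) / 2\<close> when \<open>|u|\<close> and \<open>|v|\<close> are at most \<open>A\<close>.
\<close>

lemma potential_increment:
  "((v\<^sup>2 - 1)\<^sup>2 - (u\<^sup>2 - 1)\<^sup>2) / 4
     = f_cubic u * (v - u) + (v - u)\<^sup>2 * ((v + u)\<^sup>2 / 4 + u\<^sup>2 / 2 - 1 / 2)"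
  by (simp add: f_cubic_def power2_eq_square power3_eq_cube field_simps)

text \<open>
  By Parseval everything but the quartic part of the energy splits into modes.  In each mode the scheme
  expresses the coefficient of \<open>f(u)\<close> through those of \<open>v\<close> and of \<open>\<delta> = v - u\<close>, which turns the first
  variation of the energy into the dissipation; the second-order remainder of the potential is
  controlled pointwise by \<open>A\<close>.
\<close>

lemma energy_step_le:
  fixes N :: nat and U V :: "int \<times> int \<Rightarrow> complex" and A \<tau> :: real
  defines "u \<equiv> trig_poly N U" and "v \<equiv> trig_poly N V"
  assumes "0 < \<tau>" "hermitian U" "hermitian V" and scheme: "scheme_coeffs N \<tau> U V"
    and u: "AE x in torus. \<bar>u x\<bar> \<le> A" and v: "AE x in torus. \<bar>v x\<bar> \<le> A"
    and A: "(3 * A\<^sup>2 - 1) / 2 \<le> sqrt (2 / \<tau>)"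
  shows "energy v \<le> energy u"
proof -
  let ?s = "sqrt (2 / \<tau>)"
  let ?F = "fourier_coeff (\<lambda>x. f_cubic (u x))"
  define D where "D k = V k - U k" for k
  have hermD: "hermitian D"
    unfolding D_def by (intro hermitian_diff assms)
  have D: "v x - u x = trig_poly N D x" for x
    unfolding u_def v_def D_def by (rule trig_poly_diff)
  have cont: "continuous_on UNIV u" "continuous_on UNIV v" "continuous_on UNIV (trig_poly N D)"
    unfolding u_def v_def by (intro continuous_intros)+
  have contf: "continuous_on UNIV (\<lambda>x. f_cubic (u x))"
    unfolding f_cubic_def by (intro continuous_intros cont)

  have "(\<integral>x. ((v x)\<^sup>2 - 1)\<^sup>2 \<partial>torus) / 4 - (\<integral>x. ((u x)\<^sup>2 - 1)\<^sup>2 \<partial>torus) / 4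
      = (\<integral>x. (((v x)\<^sup>2 - 1)\<^sup>2 - ((u x)\<^sup>2 - 1)\<^sup>2) / 4 \<partial>torus)"
    by (simp add: diff_divide_distrib integrable_torus_if_continuous continuous_intros cont)
  also have "\<dots> \<le> (\<integral>x. f_cubic (u x) * trig_poly N D x + ?s * (trig_poly N D x)\<^sup>2 \<partial>torus)"
  proof (rule integral_mono_AE)
    show "integrable torus (\<lambda>x. (((v x)\<^sup>2 - 1)\<^sup>2 - ((u x)\<^sup>2 - 1)\<^sup>2) / 4)"
      by (intro integrable_torus_if_continuous continuous_intros cont) auto
    show "integrable torus (\<lambda>x. f_cubic (u x) * trig_poly N D x + ?s * (trig_poly N D x)\<^sup>2)"
      by (intro integrable_torus_if_continuous continuous_intros cont contf)
    show "AE x in torus. (((v x)\<^sup>2 - 1)\<^sup>2 - ((u x)\<^sup>2 - 1)\<^sup>2) / 4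
        \<le> f_cubic (u x) * trig_poly N D x + ?s * (trig_poly N D x)\<^sup>2"
      using u v
    proof eventually_elim
      case (elim x)
      have u2: "(u x)\<^sup>2 \<le> A\<^sup>2" and v2: "(v x)\<^sup>2 \<le> A\<^sup>2"
        using elim by (auto intro: power2_le_iff_abs_le[THEN iffD2])
      have "(v x + u x)\<^sup>2 \<le> 2 * (v x)\<^sup>2 + 2 * (u x)\<^sup>2"
        using zero_le_power2[of "v x - u x"] by (simp add: power2_eq_square algebra_simps)
      then have "(v x + u x)\<^sup>2 / 4 + (u x)\<^sup>2 / 2 - 1 / 2 \<le> ?s"
        using u2 v2 A by (simp add: field_simps)
      then have "(v x - u x)\<^sup>2 * ((v x + u x)\<^sup>2 / 4 + (u x)\<^sup>2 / 2 - 1 / 2) \<le> (v x - u x)\<^sup>2 * ?s"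
        by (intro mult_left_mono) auto
      then show ?case
        unfolding potential_increment D[symmetric] by (simp add: mult.commute)
    qed
  qed
  also have "\<dots> = (\<Sum>k\<in>modes N. Re (?F k * cnj (D k))) + ?s * (\<Sum>k\<in>modes N. (cmod (D k))\<^sup>2)"
    by (simp add: integrable_torus_if_continuous continuous_intros cont contf
        integral_mult_trig_poly[OF hermD contf] parseval_trig_poly[OF hermD])
  finally have pot: "(\<integral>x. ((v x)\<^sup>2 - 1)\<^sup>2 \<partial>torus) / 4 - (\<integral>x. ((u x)\<^sup>2 - 1)\<^sup>2 \<partial>torus) / 4
      \<le> (\<Sum>k\<in>modes N. Re (?F k * cnj (D k))) + ?s * (\<Sum>k\<in>modes N. (cmod (D k))\<^sup>2)" .

  have mode: "eigenvalue k * (cmod (V k))\<^sup>2 / 2 - eigenvalue k * (cmod (U k))\<^sup>2 / 2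
      + Re (?F k * cnj (D k)) + ?s * (cmod (D k))\<^sup>2 \<le> 0" if k: "k \<in> modes N" for k
  proof (cases "k = 0")
    case True
    then have "D k = 0"
      using scheme k by (simp add: scheme_coeffs_def D_def)
    then show ?thesis
      using True by simp
  next
    case False
    define l where "l = eigenvalue k"
    have l: "0 < l" unfolding l_def by (rule eigenvalue_pos[OF False])
    have "D k = - of_real (\<tau> * l\<^sup>2) * V k - of_real (\<tau> * l) * ?F k"
      using scheme k by (simp add: scheme_coeffs_def D_def u_def l_def)
    then have "of_real (\<tau> * l) * ?F k = - D k - of_real (\<tau> * l\<^sup>2) * V k"
      by simp
    then have F: "?F k = - of_real (1 / (\<tau> * l)) * D k - of_real l * V k"
      using l \<open>0 < \<tau>\<close> by (simp add: field_simps power2_eq_square)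
    have U: "U k = V k - D k" by (simp add: D_def)
    have "l * (cmod (V k))\<^sup>2 / 2 - l * (cmod (V k - D k))\<^sup>2 / 2
        + Re ((- of_real m * D k - of_real l * V k) * cnj (D k)) = - (m + l / 2) * (cmod (D k))\<^sup>2" for m
      unfolding cmod_power2 by (simp add: power2_eq_square field_simps)
    then have "l * (cmod (V k))\<^sup>2 / 2 - l * (cmod (U k))\<^sup>2 / 2 + Re (?F k * cnj (D k))
        = - (1 / (\<tau> * l) + l / 2) * (cmod (D k))\<^sup>2"
      unfolding F U .
    \<comment> \<open>The product of \<open>1 / (\<tau> * l)\<close> and \<open>l / 2\<close> does not depend on the mode.\<close>
    moreover have "?s \<le> 1 / (\<tau> * l) + l / 2"
    proof (rule real_le_lsqrt)
      have "0 \<le> (1 / (\<tau> * l) - l / 2)\<^sup>2" by simp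
      also have "\<dots> = (1 / (\<tau> * l) + l / 2)\<^sup>2 - 2 / \<tau>"
        using l \<open>0 < \<tau>\<close> by (simp add: power2_eq_square field_simps)
      finally show "2 / \<tau> \<le> (1 / (\<tau> * l) + l / 2)\<^sup>2" by simp
    qed (use l \<open>0 < \<tau>\<close> in auto)
    then have "?s * (cmod (D k))\<^sup>2 \<le> (1 / (\<tau> * l) + l / 2) * (cmod (D k))\<^sup>2"
      by (intro mult_right_mono) auto
    ultimately show ?thesis
      unfolding l_def by linarith
  qed
  have "(\<Sum>k\<in>modes N. eigenvalue k * (cmod (V k))\<^sup>2 / 2 - eigenvalue k * (cmod (U k))\<^sup>2 / 2
      + Re (?F k * cnj (D k)) + ?s * (cmod (D k))\<^sup>2) \<le> 0"
    by (intro sum_nonpos mode)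
  then show ?thesis
    using pot unfolding u_def v_def energy_trig_poly[OF assms(4)] energy_trig_poly[OF assms(5)]
    by (simp add: sum.distrib sum_subtractf sum_distrib_left sum_divide_distrib)
qed

text \<open>
  The sup norm of the new iterate is at most the sum of the moduli of its coefficients.  They come from
  the old iterate and from the nonlinearity; a single application of the Cauchy-Schwarz inequality to
  both contributions uses the gradient part and the potential part of one and the same energy, which
  gives a better constant than estimating them separately by the full energy.
\<close>

lemma sup_step_le:
  fixes A t :: real
  assumes "0 < t" "0 < A" "hermitian U" and scheme: "scheme_coeffs N (t ^ 4) U V" and U0: "U 0 = 0"
    and u: "AE x in torus. \<bar>trig_poly N U x\<bar> \<le> A"
  shows "(\<Sum>k\<in>modes N. cmod (V k))\<^sup>2 \<le> energy (trig_poly N U) * (5 / 81 * (1 / t + 2 * A\<^sup>2 * t))"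
proof -
  let ?K = "modes N - {0}"
  define u where "u = trig_poly N U"
  define F where "F = fourier_coeff (\<lambda>x. f_cubic (u x))"
  define l where "l = eigenvalue"
  have l: "0 < l k" if "k \<in> ?K" for k
    using that unfolding l_def by (intro eigenvalue_pos) auto
  define P where "P k = l k * (cmod (U k))\<^sup>2 / 2 + (cmod (F k))\<^sup>2 / (4 * A\<^sup>2)" for k
  define Q where "Q k = 2 / (l k * (1 + t ^ 4 * (l k)\<^sup>2)\<^sup>2) + 4 * A\<^sup>2 * (t ^ 8 * (l k)\<^sup>2) / (1 + t ^ 4 * (l k)\<^sup>2)\<^sup>2" for k
  have cont: "continuous_on UNIV u"
    unfolding u_def by (intro continuous_intros)
  have contf: "continuous_on UNIV (\<lambda>x. f_cubic (u x))"
    unfolding f_cubic_def by (intro continuous_intros cont)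

  have V0: "V 0 = 0"
  proof -
    have "0 \<in> modes N" by (simp add: modes_def)
    with scheme U0 show ?thesis
      unfolding scheme_coeffs_def by (metis (no_types) bspec eigenvalue_0 diff_zero minus_zero mult_zero_left mult_zero_right of_real_0 zero_power2)
  qed
  have PQ: "0 \<le> P k" "0 \<le> Q k" if "k \<in> ?K" for k
    using l[OF that] unfolding P_def Q_def by auto

  \<comment> \<open>\<open>P\<close> adds up to at most the energy, and \<open>Q\<close> consists of the squared multipliers.\<close>
  have V: "cmod (V k) \<le> sqrt (P k) * sqrt (Q k)" if k: "k \<in> ?K" for k
  proof -
    define d where "d = 1 + t ^ 4 * (l k)\<^sup>2"
    have d: "0 < d" unfolding d_def by (simp add: add_pos_nonneg)
    have "of_real d * V k = U k - of_real (t ^ 4 * l k) * F k"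
      using scheme k by (simp add: scheme_coeffs_def d_def l_def F_def u_def algebra_simps)
    then have "cmod (of_real d * V k) \<le> cmod (U k) + t ^ 4 * l k * cmod (F k)"
      using l[OF k] \<open>0 < t\<close> norm_triangle_ineq4[of "U k" "of_real (t ^ 4 * l k) * F k"]
      by (simp add: norm_mult norm_power)
    then have "cmod (V k) \<le> (cmod (U k) + t ^ 4 * l k * cmod (F k)) / d"
      using d by (simp add: norm_mult field_simps)
    also have "\<dots> = (sqrt (l k / 2) * cmod (U k)) * (sqrt 2 / (sqrt (l k) * d))
        + (cmod (F k) / (2 * A)) * (2 * A * (t ^ 4 * l k) / d)"
      using l[OF k] d \<open>0 < A\<close> by (simp add: real_sqrt_divide field_simps)
    also have "\<dots> \<le> sqrt ((sqrt (l k / 2) * cmod (U k))\<^sup>2 + (cmod (F k) / (2 * A))\<^sup>2)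
        * sqrt ((sqrt 2 / (sqrt (l k) * d))\<^sup>2 + (2 * A * (t ^ 4 * l k) / d)\<^sup>2)"
    proof -
      have cs: "a * b + c * e \<le> sqrt (a\<^sup>2 + c\<^sup>2) * sqrt (b\<^sup>2 + e\<^sup>2)" for a b c e :: real
        unfolding real_sqrt_mult[symmetric]
      proof (rule real_le_rsqrt)
        have "(a\<^sup>2 + c\<^sup>2) * (b\<^sup>2 + e\<^sup>2) - (a * b + c * e)\<^sup>2 = (a * e - c * b)\<^sup>2"
          by (simp add: power2_eq_square algebra_simps)
        then show "(a * b + c * e)\<^sup>2 \<le> (a\<^sup>2 + c\<^sup>2) * (b\<^sup>2 + e\<^sup>2)"
          by (metis diff_ge_0_iff_ge zero_le_power2)
      qed
      show ?thesis by (rule cs)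
    qed
    also have "(sqrt (l k / 2) * cmod (U k))\<^sup>2 + (cmod (F k) / (2 * A))\<^sup>2 = P k"
      using l[OF k] by (simp add: P_def power_mult_distrib power_divide)
    also have "(sqrt 2 / (sqrt (l k) * d))\<^sup>2 + (2 * A * (t ^ 4 * l k) / d)\<^sup>2 = Q k"
      using l[OF k] by (simp add: Q_def d_def power_mult_distrib power_divide flip: power_mult)
    finally show ?thesis .
  qed

  have "(\<Sum>k\<in>modes N. cmod (V k)) = (\<Sum>k\<in>?K. cmod (V k))"
    by (rule sum.mono_neutral_right) (auto simp: V0)
  also have "\<dots> \<le> (\<Sum>k\<in>?K. sqrt (P k) * sqrt (Q k))"
    by (intro sum_mono V)
  finally have "(\<Sum>k\<in>modes N. cmod (V k))\<^sup>2 \<le> (\<Sum>k\<in>?K. sqrt (P k) * sqrt (Q k))\<^sup>2"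
    by (intro power_mono) (auto intro: sum_nonneg)
  also have "\<dots> \<le> (\<Sum>k\<in>?K. (sqrt (P k))\<^sup>2) * (\<Sum>k\<in>?K. (sqrt (Q k))\<^sup>2)"
    by (rule Cauchy_Schwarz_ineq_sum)
  also have "\<dots> = (\<Sum>k\<in>?K. P k) * (\<Sum>k\<in>?K. Q k)"
    using PQ by simp
  also have "\<dots> \<le> energy u * (5 / 81 * (1 / t + 2 * A\<^sup>2 * t))"
  proof (rule mult_mono)
    have "(\<Sum>k\<in>modes N. (cmod (F k))\<^sup>2) \<le> (\<integral>x. (f_cubic (u x))\<^sup>2 \<partial>torus)"
      unfolding F_def by (rule bessel_inequality[OF contf])
    also have "\<dots> \<le> (\<integral>x. A\<^sup>2 * ((u x)\<^sup>2 - 1)\<^sup>2 \<partial>torus)"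
    proof (rule integral_mono_AE)
      show "AE x in torus. (f_cubic (u x))\<^sup>2 \<le> A\<^sup>2 * ((u x)\<^sup>2 - 1)\<^sup>2"
        using u
      proof eventually_elim
        case (elim x)
        then have "(u x)\<^sup>2 \<le> A\<^sup>2"
          unfolding u_def by (auto intro: power2_le_iff_abs_le[THEN iffD2])
        then have "(u x)\<^sup>2 * ((u x)\<^sup>2 - 1)\<^sup>2 \<le> A\<^sup>2 * ((u x)\<^sup>2 - 1)\<^sup>2"
          by (intro mult_right_mono) auto
        also have "(u x)\<^sup>2 * ((u x)\<^sup>2 - 1)\<^sup>2 = (f_cubic (u x))\<^sup>2"
          by (simp add: f_cubic_def power2_eq_square power3_eq_cube algebra_simps)
        finally show ?case .
      qed
    qed (intro integrable_torus_if_continuous continuous_intros cont contf)+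
    also have "\<dots> = A\<^sup>2 * (\<integral>x. ((u x)\<^sup>2 - 1)\<^sup>2 \<partial>torus)"
      by simp
    finally have F: "(\<Sum>k\<in>modes N. (cmod (F k))\<^sup>2) / (4 * A\<^sup>2) \<le> (\<integral>x. ((u x)\<^sup>2 - 1)\<^sup>2 \<partial>torus) / 4"
      using \<open>0 < A\<close> by (simp add: field_simps)
    have "(\<Sum>k\<in>?K. P k) \<le> (\<Sum>k\<in>modes N. P k)"
      by (rule sum_mono2) (auto simp: P_def l_def)
    also have "\<dots> = (\<Sum>k\<in>modes N. l k * (cmod (U k))\<^sup>2) / 2 + (\<Sum>k\<in>modes N. (cmod (F k))\<^sup>2) / (4 * A\<^sup>2)"
      by (simp add: P_def sum.distrib sum_divide_distrib)
    also have "\<dots> \<le> energy u"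
      using F unfolding u_def energy_trig_poly[OF assms(3)] l_def by linarith
    finally show "(\<Sum>k\<in>?K. P k) \<le> energy u" .
    then show "0 \<le> energy u"
      using PQ by (meson order_trans sum_nonneg)
    show "0 \<le> (\<Sum>k\<in>?K. Q k)"
      using PQ by (intro sum_nonneg) auto
    have "Q k \<le> (1 / t + 2 * A\<^sup>2 * t) * (1 / sqrt (eigenvalue k) ^ 3)" if k: "k \<in> ?K" for k
    proof -
      define r where "r = sqrt (l k)"
      have r: "0 < r" "l k = r\<^sup>2" using l[OF k] by (auto simp: r_def)
      have "Q k = 2 * (1 / (r\<^sup>2 * (1 + (t * r) ^ 4)\<^sup>2))
          + 4 * A\<^sup>2 * (t ^ 8 * r ^ 4 / (1 + (t * r) ^ 4)\<^sup>2)"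
        by (simp add: Q_def r power_mult_distrib flip: power_mult)
      also have "\<dots> \<le> 2 * (1 / (2 * t * r ^ 3)) + 4 * A\<^sup>2 * (t / (2 * r ^ 3))"
        using multiplier_bounds[OF r(1) \<open>0 < t\<close>] by (intro add_mono mult_left_mono) auto
      also have "\<dots> = (1 / t + 2 * A\<^sup>2 * t) * (1 / r ^ 3)"
        using r \<open>0 < t\<close> by (simp add: field_simps)
      finally show ?thesis by (simp add: r_def l_def)
    qed
    then have "(\<Sum>k\<in>?K. Q k) \<le> (\<Sum>k\<in>?K. (1 / t + 2 * A\<^sup>2 * t) * (1 / sqrt (eigenvalue k) ^ 3))"
      by (rule sum_mono)
    also have "\<dots> = (1 / t + 2 * A\<^sup>2 * t) * (\<Sum>k\<in>?K. 1 / sqrt (eigenvalue k) ^ 3)"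
      by (simp only: sum_distrib_left)
    also have "\<dots> \<le> (1 / t + 2 * A\<^sup>2 * t) * (5 / 81)"
      using \<open>0 < t\<close> by (intro mult_left_mono sum_inverse_eigenvalue) auto
    finally show "(\<Sum>k\<in>?K. Q k) \<le> 5 / 81 * (1 / t + 2 * A\<^sup>2 * t)"
      by (simp add: mult.commute)
  qed
  finally show ?thesis by (simp add: u_def)
qed

section \<open>The step size restriction and energy decay\<close>

lemma tau_max_bounds:
  assumes "0 < \<tau>" "0 \<le> E" "ereal \<tau> \<le> tau_max E"
  shows "\<tau> \<le> 1/2" and "\<tau> * (0.18692 * E) ^ 4 \<le> 8/9"
proof -
  have le: "ereal \<tau> \<le> ereal (1/2)" "ereal \<tau> \<le> ereal (8/9 * (1 / B2 E))"
    using assms(3) unfolding tau_max_def by (auto simp del: ereal_less_eq)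
  then show "\<tau> \<le> 1/2" by simp
  have B2: "\<tau> \<le> 8/9 * (1 / B2 E)" using le by simp
  then have "B2 E \<noteq> 0" using \<open>0 < \<tau>\<close> by auto
  moreover have "0 \<le> B2 E" by (simp add: B2_def)
  ultimately have "\<tau> * B2 E \<le> 8/9" using B2 by (simp add: field_simps)
  moreover have "(0.18692 * E) ^ 4 \<le> B2 E"
    unfolding B2_def using assms(2) by (intro power_mono) auto
  ultimately show "\<tau> * (0.18692 * E) ^ 4 \<le> 8/9"
    using \<open>0 < \<tau>\<close> by (meson mult_left_mono less_imp_le order_trans)
qed

text \<open>
  After multiplication by \<open>t\<^sup>2\<close> only \<open>E * t\<close> and \<open>a = A\<^sup>2 * t\<^sup>2\<close> remain.  The step size restriction
  bounds the former by \<open>(8/9)\<^bsup>1/4\<^esup> / 0.18692 < 5.217\<close>, and then \<open>5.217 * 5/81 * (1 + 2 * a) \<le> a\<close>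
  holds from \<open>a = 0.94\<close> on, while \<open>a\<close> is at least \<open>2 * sqrt 2 / 3 > 0.94\<close>.
\<close>

lemma sup_bound_closes:
  fixes A t E :: real
  assumes "0 < t" "0 \<le> E" and A: "A\<^sup>2 = 1/3 + 2 * sqrt 2 / (3 * t\<^sup>2)"
    and E: "t ^ 4 * (0.18692 * E) ^ 4 \<le> 8/9"
  shows "E * (5 / 81 * (1 / t + 2 * A\<^sup>2 * t)) \<le> A\<^sup>2"
proof -
  have "(0.18692 * E * t) ^ 4 \<le> (0.975 :: real) ^ 4"
    using E by (simp add: power_mult_distrib mult_ac power_divide)
  then have "0.18692 * E * t \<le> 0.975"
    by (rule power_le_imp_le_base[of _ 3, simplified]) simp
  then have Et: "E * t \<le> 5.217" by simp
  define a where "a = A\<^sup>2 * t\<^sup>2"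
  have "a = t\<^sup>2 / 3 + 2 * sqrt 2 / 3"
    using \<open>0 < t\<close> by (simp add: a_def A field_simps)
  moreover have "707/500 \<le> sqrt 2"
    by (rule real_le_rsqrt) (simp add: power2_eq_square)
  moreover have "0 \<le> t\<^sup>2" by simp
  ultimately have a: "47/50 \<le> a" by linarith
  have "E * (5 / 81 * (1 / t + 2 * A\<^sup>2 * t)) * t\<^sup>2 = (E * t) * (5 / 81 * (1 + 2 * a))"
    using \<open>0 < t\<close> by (simp add: a_def power2_eq_square field_simps)
  also have "\<dots> \<le> 5.217 * (5 / 81 * (1 + 2 * a))"
    using a by (intro mult_right_mono Et) auto
  also have "\<dots> \<le> A\<^sup>2 * t\<^sup>2"
    using a unfolding a_def[symmetric] by simp
  finally show ?thesis
    using \<open>0 < t\<close> by (simp add: mult_le_cancel_right)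
qed

theorem theorem4p2:
  fixes N :: nat and u0 :: "real \<times> real \<Rightarrow> real" and \<tau> :: real
    and u :: "nat \<Rightarrow> real \<times> real \<Rightarrow> real"
  assumes "N \<ge> 2"
    and "H1 u0" and "mean_zero u0"
    and "Linfty_norm (Proj N u0) \<le> ereal 1.25"
    and "0 < \<tau>" and "ereal \<tau> \<le> tau_max (energy (Proj N u0))"
    and "scheme_solution N \<tau> u0 u"
  shows "\<forall>n. energy (u (Suc n)) \<le> energy (u n)"
proof -
  define E0 where "E0 = energy (Proj N u0)"
  have E0: "0 \<le> E0" unfolding E0_def by (rule energy_nonneg)
  note \<tau> = tau_max_bounds[OF \<open>0 < \<tau>\<close> E0 assms(6)[folded E0_def]]
  define t where "t = root 4 \<tau>"
  have t: "0 < t" "t ^ 4 = \<tau>"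
    using \<open>0 < \<tau>\<close> by (auto simp: t_def)
  then have t2: "sqrt \<tau> = t\<^sup>2"
    by (intro real_sqrt_unique) (auto simp flip: power_mult)
  define A where "A = sqrt (1/3 + 2 * sqrt 2 / (3 * t\<^sup>2))"
  have A2: "A\<^sup>2 = 1/3 + 2 * sqrt 2 / (3 * t\<^sup>2)"
    unfolding A_def by (intro real_sqrt_pow2 add_nonneg_nonneg) auto
  have A: "0 < A"
    unfolding A_def using t by (intro real_sqrt_gt_zero add_pos_nonneg) auto
  have A_cond: "(3 * A\<^sup>2 - 1) / 2 \<le> sqrt (2 / \<tau>)"
    unfolding A2 real_sqrt_divide t2 using t by (simp add: field_simps)

  define U where "U n = fourier_coeff (u n)" for n
  have herm: "hermitian (U n)" for n
    by (simp add: U_def)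
  have init: "u 0 = Proj N u0"
    using assms(7) by (simp add: scheme_solution_def)
  have "u n \<in> XN N" for n
    using assms(7) Proj_in_XN by (cases n) (auto simp: scheme_solution_def)
  then have u: "u n = trig_poly N (U n)" for n
    unfolding U_def by (rule XN_eq_trig_poly)
  have scheme: "scheme_coeffs N \<tau> (U n) (U (Suc n))" for n
    using assms(7) by (intro scheme_coeffs_if_step \<open>0 < \<tau>\<close> herm)
      (auto simp: scheme_solution_def simp flip: u)
  have zero: "0 \<in> modes N" by (simp add: modes_def)
  have U0: "U n 0 = 0" for n
  proof (induction n)
    case 0
    have "U 0 0 = fourier_coeff u0 0"
      unfolding U_def init Proj_eq_trig_poly by (intro fourier_coeff_trig_poly zero) simp
    also have "\<dots> = 0"
      using assms(3) by (simp add: fourier_coeff_def phase_def mean_zero_def)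
    finally show ?case .
  next
    case (Suc n)
    have "U (Suc n) 0 - U n 0 = 0"
      using bspec[OF scheme[of n, unfolded scheme_coeffs_def] zero] by simp
    then show ?case using Suc by simp
  qed

  have sup: "\<bar>u (Suc n) x\<bar> \<le> A" if "energy (u n) \<le> E0" "AE x in torus. \<bar>u n x\<bar> \<le> A" for n x
  proof -
    have "(\<Sum>k\<in>modes N. cmod (U (Suc n) k))\<^sup>2 \<le> energy (u n) * (5 / 81 * (1 / t + 2 * A\<^sup>2 * t))"
      using that scheme[of n] unfolding u
      by (intro sup_step_le[OF t(1) A herm _ U0]) (auto simp: t)
    also have "\<dots> \<le> E0 * (5 / 81 * (1 / t + 2 * A\<^sup>2 * t))"
      using that t by (intro mult_right_mono) auto
    also have "\<dots> \<le> A\<^sup>2"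
      using \<tau>(2) by (intro sup_bound_closes[OF t(1) E0 A2]) (simp add: t)
    finally have "(\<Sum>k\<in>modes N. cmod (U (Suc n) k)) \<le> A"
      using A by (auto intro: power2_le_imp_le)
    then show ?thesis
      unfolding u using abs_trig_poly_le order_trans by blast
  qed
  have step: "energy (u (Suc n)) \<le> energy (u n)"
    if "energy (u n) \<le> E0" "AE x in torus. \<bar>u n x\<bar> \<le> A" for n
    using that sup[OF that] A_cond scheme[of n] unfolding u
    by (intro energy_step_le[OF \<open>0 < \<tau>\<close> herm herm]) auto

  \<comment> \<open>The bound by \<open>A\<close> is only known almost everywhere at the start, because the essential supremum
    is; from the first step on it holds everywhere.\<close>
  have "energy (u n) \<le> E0 \<and> (AE x in torus. \<bar>u n x\<bar> \<le> A)" for n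
  proof (induction n)
    case 0
    have "1.25\<^sup>2 \<le> A\<^sup>2"
    proof -
      have "t\<^sup>2 \<le> sqrt (1/2)"
        unfolding t2[symmetric] using \<tau>(1) by (rule real_sqrt_le_mono)
      then have le1: "sqrt 2 * t\<^sup>2 \<le> 1"
        by (simp add: real_sqrt_divide field_simps)
      have "2 * t\<^sup>2 = sqrt 2 * (sqrt 2 * t\<^sup>2)"
        by simp
      also have "\<dots> \<le> sqrt 2 * 1"
        using le1 by (intro mult_left_mono) auto
      finally have "4/3 \<le> 2 * sqrt 2 / (3 * t\<^sup>2)"
        using t by (simp add: field_simps)
      then show ?thesis unfolding A2 by (simp add: power2_eq_square)
    qed
    then have "1.25 \<le> A" using A by (auto intro: power2_le_imp_le)
    have "AE x in torus. ereal \<bar>u 0 x\<bar> \<le> esssup torus (\<lambda>x. ereal \<bar>u 0 x\<bar>)"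
      by (rule esssup_AE)
    then have "AE x in torus. \<bar>u 0 x\<bar> \<le> A"
    proof eventually_elim
      case (elim x)
      also have "esssup torus (\<lambda>x. ereal \<bar>u 0 x\<bar>) \<le> ereal 1.25"
        using assms(4) by (simp add: Linfty_norm_def init)
      finally show ?case using \<open>1.25 \<le> A\<close> by simp
    qed
    then show ?case by (simp add: init E0_def)
  next
    case (Suc n)
    then show ?case using step sup order_trans by blast
  qed
  then show ?thesis using step by blast
qed

end
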